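(* Let $\mathcal D_1$ and $\mathcal D_2$ be separation-equivalent directed acyclic graphs on the same finite vertex set $V$. Then for every $\sigma\in\mathbb S_1^+(\mathcal H_V)$, $$T_{\mathcal D_1}(\sigma)=T_{\mathcal D_2}(\sigma)\qquad\text{and}\qquad gI(\mathcal D_1)_\sigma=gI(\mathcal D_2)_\sigma.$$
   Context: For each $v\in V$, $\mathcal H_v$ is a finite-dimensional complex Hilbert space; $\mathcal H_A=\bigotimes_{v\in A}\mathcal H_v$ for $A\subseteq V$, with $\mathcal H_\varnothing=\mathbb C$. $\mathbb S_1^+(\mathcal H_A)$ is the set of positive definite (self-adjoint) operators on $\mathcal H_A$ of trace one. For $A\subseteq V$, $\sigma_A=\operatorname{Tr}_{V\setminus A}(\sigma)$ is the marginal; operators $\log\sigma_A$ are embedded into operators on $\mathcal H_V$ by tensoring with the identity on the complementary factors, and $\log\sigma_\varnothing=0$. For a DAG $\mathcal D$ on $V$ with parent sets $\operatorname{pa}(v)$, $$T_{\mathcal D}(\sigma)=\exp\Bigl\{\sum_{v\in V}\bigl(\log\sigma_{\{v\}\cup\operatorname{pa}(v)}-\log\sigma_{\operatorname{pa}(v)}\bigr)\Bigr\},$$ and $gI(\mathcal D)_\sigma=\sum_{v\in V}\bigl(\operatorname S(\{v\}\cup\operatorname{pa}(v))_\sigma-\operatorname S(\operatorname{pa}(v))_\sigma\bigr)-\operatorname S(V)_\sigma$, where $\operatorname S(A)_\sigma=-\operatorname{Tr}(\sigma_A\log\sigma_A)$ and $\operatorname S(\varnothing)_\sigma=0$. A walk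 in a DAG (repeated vertices allowed, arrows traversable in either direction) has a collider at a non-endpoint $\alpha_i$ if $\alpha_{i-1}\to\alpha_i\leftarrow\alpha_{i+1}$. A walk is active relative to $S\subseteq V$ if every non-collider on it is outside $S$ and every collider on it is in $S$; otherwise it is blocked by $S$. Disjoint $A,B$ (both disjoint from $S$) are $d$-separated by $S$ if every walk from $A$ to $B$ is blocked by $S$. Two DAGs on $V$ are separation equivalent if they have the same $d$-separation statements; by the classical criterion, this holds if and only if they have the same skeleton (underlying undirected graph) and the same unshielded colliders (induced subgraphs $\alpha\to\gamma\leftarrow\beta$ with $\alpha,\beta$ non-adjacent). *)

theory Defs
  imports Complex_Main "HOL-Library.FuncSet"
begin

section \<open>Operators on finite-dimensional Hilbert spaces\<close>

text \<open>
  A finite-dimensional complex Hilbert space is given by a finite set \<open>I\<close> indexing an orthonormal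
  basis, i.e. it is the space of functions \<open>I \<rightarrow> \<complex>\<close> with the standard inner product. An operator is
  its matrix, represented by a function that vanishes outside \<open>I \<times> I\<close>, so that equality of
  operators is equality of functions.
\<close>

type_synonym 'i oper = "'i \<Rightarrow> 'i \<Rightarrow> complex"

definition operators :: "'i set \<Rightarrow> 'i oper set" where
  "operators I = {M. \<forall>i j. i \<notin> I \<or> j \<notin> I \<longrightarrow> M i j = 0}"

definition op_one :: "'i set \<Rightarrow> 'i oper" where
  "op_one I = (\<lambda>i j. if i \<in> I \<and> i = j then 1 else 0)"

definition op_mult :: "'i set \<Rightarrow> 'i oper \<Rightarrow> 'i oper \<Rightarrow> 'i oper" where
  "op_mult I M N = (\<lambda>i j. \<Sum>k\<in>I. M i k * N k j)"

primrec op_power :: "'i set \<Rightarrow> 'i oper \<Rightarrow> nat \<Rightarrow> 'i oper" where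
  "op_power I M 0 = op_one I"
| "op_power I M (Suc n) = op_mult I M (op_power I M n)"

definition op_trace :: "'i set \<Rightarrow> 'i oper \<Rightarrow> complex" where
  "op_trace I M = (\<Sum>i\<in>I. M i i)"

definition self_adjoint :: "'i set \<Rightarrow> 'i oper \<Rightarrow> bool" where
  "self_adjoint I M \<longleftrightarrow> M \<in> operators I \<and> (\<forall>i\<in>I. \<forall>j\<in>I. M i j = cnj (M j i))"

definition pos_definite :: "'i set \<Rightarrow> 'i oper \<Rightarrow> bool" where
  "pos_definite I M \<longleftrightarrow> self_adjoint I M \<and>
     (\<forall>x. (\<exists>i\<in>I. x i \<noteq> 0) \<longrightarrow> 0 < Re (\<Sum>i\<in>I. \<Sum>j\<in>I. cnj (x i) * M i j * x j))"

definition op_exp :: "'i set \<Rightarrow> 'i oper \<Rightarrow> 'i oper" where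
  "op_exp I M = (\<lambda>i j. \<Sum>n. op_power I M n i j / fact n)"

text \<open>
  The exponential is a bijection from the self-adjoint to the positive definite operators; the
  logarithm of a positive definite operator is its inverse.
\<close>

definition op_log :: "'i set \<Rightarrow> 'i oper \<Rightarrow> 'i oper" where
  "op_log I M = (THE L. self_adjoint I L \<and> op_exp I L = M)"


section \<open>Multipartite systems\<close>

text \<open>
  \<open>X v\<close> indexes an orthonormal basis of the local space at \<open>v\<close>, so the product basis of
  the tensor product over \<open>A\<close> is indexed by \<open>\<Pi>\<^sub>E v\<in>A. X v\<close>. For \<open>A = {}\<close> this is a singleton
  and the space is \<open>\<complex>\<close>.
\<close>

abbreviation basis :: "('v \<Rightarrow> 'b set) \<Rightarrow> 'v set \<Rightarrow> ('v \<Rightarrow> 'b) set" where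
  "basis X A \<equiv> Pi\<^sub>E A X"

definition states :: "('v \<Rightarrow> 'b set) \<Rightarrow> 'v set \<Rightarrow> ('v \<Rightarrow> 'b) oper set" where
  "states X A = {\<sigma>. pos_definite (basis X A) \<sigma> \<and> op_trace (basis X A) \<sigma> = 1}"

text \<open>
  Partial trace over \<open>V - A\<close>. For \<open>i\<close> in \<open>basis X A\<close> and \<open>k\<close> in \<open>basis X (V - A)\<close>,
  \<open>override_on k i A\<close> is the joint index in \<open>basis X V\<close>.
\<close>

definition marginal ::
  "('v \<Rightarrow> 'b set) \<Rightarrow> 'v set \<Rightarrow> 'v set \<Rightarrow> ('v \<Rightarrow> 'b) oper \<Rightarrow> ('v \<Rightarrow> 'b) oper" where
  "marginal X V A \<sigma> = (\<lambda>i j. if i \<in> basis X A \<and> j \<in> basis X A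
     then \<Sum>k\<in>basis X (V - A). \<sigma> (override_on k i A) (override_on k j A) else 0)"

text \<open>The operator \<open>M \<otimes> 1\<close>, where \<open>1\<close> is the identity on the factors in \<open>V - A\<close>.\<close>

definition embed ::
  "('v \<Rightarrow> 'b set) \<Rightarrow> 'v set \<Rightarrow> 'v set \<Rightarrow> ('v \<Rightarrow> 'b) oper \<Rightarrow> ('v \<Rightarrow> 'b) oper" where
  "embed X V A M = (\<lambda>i j. if i \<in> basis X V \<and> j \<in> basis X V
     then M (restrict i A) (restrict j A) *
       op_one (basis X (V - A)) (restrict i (V - A)) (restrict j (V - A))
     else 0)"

definition log_marginal ::
  "('v \<Rightarrow> 'b set) \<Rightarrow> 'v set \<Rightarrow> 'v set \<Rightarrow> ('v \<Rightarrow> 'b) oper \<Rightarrow> ('v \<Rightarrow> 'b) oper" where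
  "log_marginal X V A \<sigma> = op_log (basis X A) (marginal X V A \<sigma>)"

text \<open>The trace below is real, so taking the real part only changes the type.\<close>

definition entropy ::
  "('v \<Rightarrow> 'b set) \<Rightarrow> 'v set \<Rightarrow> 'v set \<Rightarrow> ('v \<Rightarrow> 'b) oper \<Rightarrow> real" where
  "entropy X V A \<sigma> =
     - Re (op_trace (basis X A) (op_mult (basis X A) (marginal X V A \<sigma>) (log_marginal X V A \<sigma>)))"


section \<open>Directed acyclic graphs and d-separation\<close>

definition dag :: "'v set \<Rightarrow> ('v \<times> 'v) set \<Rightarrow> bool" where
  "dag V D \<longleftrightarrow> D \<subseteq> V \<times> V \<and> acyclic D"

definition parents :: "('v \<times> 'v) set \<Rightarrow> 'v \<Rightarrow> 'v set" where
  "parents D v = {u. (u, v) \<in> D}"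

text \<open>
  A walk is its list of vertices; between two vertices of an acyclic graph there is at most one
  arrow, so the arrows traversed are determined. Colliders are positions in the walk, as vertices
  may be repeated.
\<close>

definition walk :: "'v set \<Rightarrow> ('v \<times> 'v) set \<Rightarrow> 'v list \<Rightarrow> bool" where
  "walk V D w \<longleftrightarrow> w \<noteq> [] \<and> set w \<subseteq> V \<and> successively (\<lambda>a b. (a, b) \<in> D \<or> (b, a) \<in> D) w"

definition collider_at :: "('v \<times> 'v) set \<Rightarrow> 'v list \<Rightarrow> nat \<Rightarrow> bool" where
  "collider_at D w i \<longleftrightarrow> 0 < i \<and> Suc i < length w \<and>
     (w ! (i - 1), w ! i) \<in> D \<and> (w ! Suc i, w ! i) \<in> D"

definition active_walk :: "'v set \<Rightarrow> ('v \<times> 'v) set \<Rightarrow> 'v set \<Rightarrow> 'v list \<Rightarrow> bool" where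
  "active_walk V D S w \<longleftrightarrow> walk V D w \<and>
     (\<forall>i<length w. if collider_at D w i then w ! i \<in> S else w ! i \<notin> S)"

definition d_separated ::
  "'v set \<Rightarrow> ('v \<times> 'v) set \<Rightarrow> 'v set \<Rightarrow> 'v set \<Rightarrow> 'v set \<Rightarrow> bool" where
  "d_separated V D A B S \<longleftrightarrow>
     A \<subseteq> V \<and> B \<subseteq> V \<and> S \<subseteq> V \<and> A \<inter> B = {} \<and> A \<inter> S = {} \<and> B \<inter> S = {} \<and>
     (\<forall>w. walk V D w \<and> hd w \<in> A \<and> last w \<in> B \<longrightarrow> \<not> active_walk V D S w)"

definition separation_equivalent :: "'v set \<Rightarrow> ('v \<times> 'v) set \<Rightarrow> ('v \<times> 'v) set \<Rightarrow> bool" where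
  "separation_equivalent V D1 D2 \<longleftrightarrow>
     (\<forall>A B S. d_separated V D1 A B S \<longleftrightarrow> d_separated V D2 A B S)"


section \<open>The operator and the information of a directed acyclic graph\<close>

definition T_op ::
  "('v \<Rightarrow> 'b set) \<Rightarrow> 'v set \<Rightarrow> ('v \<times> 'v) set \<Rightarrow> ('v \<Rightarrow> 'b) oper \<Rightarrow> ('v \<Rightarrow> 'b) oper" where
  "T_op X V D \<sigma> = op_exp (basis X V) (\<lambda>i j. \<Sum>v\<in>V.
     embed X V ({v} \<union> parents D v) (log_marginal X V ({v} \<union> parents D v) \<sigma>) i j
     - embed X V (parents D v) (log_marginal X V (parents D v) \<sigma>) i j)"

definition gI ::
  "('v \<Rightarrow> 'b set) \<Rightarrow> 'v set \<Rightarrow> ('v \<times> 'v) set \<Rightarrow> ('v \<Rightarrow> 'b) oper \<Rightarrow> real" where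
  "gI X V D \<sigma> =
     (\<Sum>v\<in>V. entropy X V ({v} \<union> parents D v) \<sigma> - entropy X V (parents D v) \<sigma>) - entropy X V V \<sigma>"


section \<open>Conventions for the empty set of vertices\<close>

text \<open>
  The conventions that the logarithm of the marginal on \<open>{}\<close> and its entropy are zero need no
  special case in the definitions.
\<close>

lemma op_exp_singleton:
  assumes "M \<in> operators {x}"
  shows "op_exp {x} M = (\<lambda>i j. if i = x \<and> j = x then exp (M x x) else 0)"
proof -
  have p: "op_power {x} M n i j = (if i = x \<and> j = x then M x x ^ n else 0)" for n i j
    using assms by (induction n arbitrary: i j) (auto simp: op_one_def op_mult_def operators_def)
  have "(\<Sum>n. M x x ^ n / fact n) = exp (M x x)"
    by (simp add: exp_def scaleR_conv_of_real field_simps)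
  then show ?thesis
    by (auto simp: op_exp_def p fun_eq_iff)
qed

lemma marginal_empty:
  assumes "\<sigma> \<in> states X V"
  shows "marginal X V {} \<sigma> = op_one (basis X {})"
  using assms by (intro ext) (auto simp: marginal_def states_def op_trace_def op_one_def)

lemma log_marginal_empty:
  assumes "\<sigma> \<in> states X V"
  shows "log_marginal X V {} \<sigma> = (\<lambda>i j. 0)"
proof -
  define x where "x = (\<lambda>_::'a. undefined :: 'b)"
  have "L = (\<lambda>i j. 0)" if L: "self_adjoint {x} L" "op_exp {x} L = op_one {x}" for L
  proof -
    have op: "L \<in> operators {x}" and cnj: "L x x = cnj (L x x)"
      using L(1) by (auto simp: self_adjoint_def)
    have "exp (L x x) = 1"
      using fun_cong[OF fun_cong[OF L(2)], of x x] by (simp add: op_exp_singleton[OF op] op_one_def)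
    moreover have "L x x = of_real (Re (L x x))"
      using cnj by (metis Reals_cnj_iff of_real_Re)
    ultimately have "L x x = 0"
      by (metis exp_eq_one_iff exp_of_real of_real_0 of_real_1 of_real_eq_iff)
    then show ?thesis
      using op unfolding operators_def by (intro ext) (metis (mono_tags, lifting) mem_Collect_eq singletonD)
  qed
  moreover have z: "(\<lambda>i j. 0) \<in> operators {x}"
    by (simp add: operators_def)
  have "self_adjoint {x} (\<lambda>i j. 0) \<and> op_exp {x} (\<lambda>i j. 0) = op_one {x}"
    using z by (auto simp: self_adjoint_def op_exp_singleton[OF z] op_one_def intro!: ext)
  ultimately show ?thesis
    unfolding log_marginal_def op_log_def marginal_empty[OF assms] PiE_empty_domain x_def[symmetric]
    by (intro the_equality) blast+
qed

lemma entropy_empty: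
  assumes "\<sigma> \<in> states X V"
  shows "entropy X V {} \<sigma> = 0"
  using assms by (simp add: entropy_def log_marginal_empty op_mult_def op_trace_def)

end

theory Submission
  imports Defs
begin

text \<open>
  Both quantities are instances of \<open>\<Sum>v\<in>V. f (insert v (pa v)) - f (pa v)\<close> for a set function \<open>f\<close>.
  Writing \<open>f A = (\<Sum>T\<in>Pow A. g T)\<close> by Moebius inversion, acyclicity turns this sum into the sum of
  \<open>g\<close> over the sets \<open>T\<close> that have an element \<open>v\<close> with \<open>T - {v} \<subseteq> pa v\<close>. Such sets depend only on
  the skeleton and the unshielded colliders: any sink of \<open>T\<close> in the other graph is again an element
  of this kind. That d-separation determines these two data uses only that non-adjacent \<open>a\<close>, \<open>b\<close>
  are separated by \<open>pa a\<close> or by \<open>pa b\<close>.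
\<close>

definition adjacent :: "('v \<times> 'v) set \<Rightarrow> 'v \<Rightarrow> 'v \<Rightarrow> bool" where
  "adjacent D a b \<longleftrightarrow> (a, b) \<in> D \<or> (b, a) \<in> D"

text \<open>For a dag, these are the nonempty vertex sets at which Studeny's characteristic imset
  takes the value 1.\<close>

definition partial_families :: "'v set \<Rightarrow> ('v \<times> 'v) set \<Rightarrow> 'v set set" where
  "partial_families V D = (\<Union>v\<in>V. insert v ` Pow (parents D v))"

lemma adjacent_sym: "adjacent D a b \<longleftrightarrow> adjacent D b a"
  by (auto simp: adjacent_def)

lemma dag_antisym: "dag V D \<Longrightarrow> (a, b) \<in> D \<Longrightarrow> (b, a) \<notin> D"
  unfolding dag_def acyclic_def by (meson r_into_trancl trancl_into_trancl)

lemma dag_subset_parents: "dag V D \<Longrightarrow> parents D v \<subseteq> V"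
  by (auto simp: dag_def parents_def)

lemma dag_not_parent_self: "dag V D \<Longrightarrow> v \<notin> parents D v"
  using dag_antisym by (fastforce simp: parents_def)

text \<open>The first arrow cannot point to \<open>w ! 0\<close>: a parent in second position would
  have to be a collider, which takes an arrow out of \<open>w ! 0\<close>. From then on each vertex
  is a proper descendant of \<open>w ! 0\<close>, hence by acyclicity outside the conditioning set
  and not a collider, so the arrow entering it can only be followed by one leaving it.\<close>

lemma active_walk_parents_directed:
  assumes "dag V D" "active_walk V D (parents D (w ! 0)) w" "i < length w"
  shows "(w ! 0, w ! i) \<in> D\<^sup>* \<and> (Suc i < length w \<longrightarrow> (w ! i, w ! Suc i) \<in> D)"
  using assms(3)
proof (induction i)
  have adj: "(w ! i, w ! Suc i) \<in> D \<or> (w ! Suc i, w ! i) \<in> D" if "Suc i < length w" for i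
    using assms(2) that by (auto simp: active_walk_def walk_def successively_conv_nth)
  \<comment> \<open>Endpoints count as non-colliders, so a walk that stops at a parent of
    \<open>w ! 0\<close> is excluded as well.\<close>
  have act: "collider_at D w i \<longleftrightarrow> w ! i \<in> parents D (w ! 0)" if "i < length w" for i
    using assms(2) that unfolding active_walk_def by metis
  {
    case 0
    show ?case
    proof (intro conjI impI)
      assume len: "Suc 0 < length w"
      show "(w ! 0, w ! Suc 0) \<in> D"
      proof (rule ccontr)
        assume no: "(w ! 0, w ! Suc 0) \<notin> D"
        then have "w ! Suc 0 \<in> parents D (w ! 0)"
          using adj[OF len] by (simp add: parents_def)
        then show False
          using act[OF len] no by (simp add: collider_at_def)
      qed
    qed simp
  next
    case (Suc i)
    then have i: "(w ! 0, w ! i) \<in> D\<^sup>*" "(w ! i, w ! Suc i) \<in> D"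
      by auto
    then have desc: "(w ! 0, w ! Suc i) \<in> D\<^sup>*"
      by (rule rtrancl_into_rtrancl)
    have "(w ! Suc i, w ! 0) \<notin> D"
      using desc assms(1) unfolding dag_def acyclic_def by (meson rtrancl_into_trancl1)
    then have "\<not> collider_at D w (Suc i)"
      using act[OF Suc.prems] by (simp add: parents_def)
    then show ?case
      using desc i(2) adj[of "Suc i"] by (auto simp: collider_at_def)
  }
qed

text \<open>A walk from \<open>b\<close> that is active relative to the parents of \<open>b\<close>
  visits only descendants of \<open>b\<close>, so it cannot end at \<open>a\<close>.\<close>

lemma d_separated_parents:
  assumes "dag V D" "a \<in> V" "b \<in> V" "a \<noteq> b" "\<not> adjacent D a b" "(b, a) \<notin> D\<^sup>*"
  shows "d_separated V D {b} {a} (parents D b)"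
proof -
  have "(b, last w) \<in> D\<^sup>*" if "active_walk V D (parents D b) w" "hd w = b" for w
  proof -
    have "w \<noteq> []"
      using that(1) by (simp add: active_walk_def walk_def)
    then show ?thesis
      using active_walk_parents_directed[OF assms(1), of w "length w - 1"] that
      by (simp add: hd_conv_nth last_conv_nth)
  qed
  then show ?thesis
    using assms dag_subset_parents[OF assms(1)] dag_not_parent_self[OF assms(1)]
    by (auto simp: d_separated_def adjacent_def parents_def)
qed

text \<open>By acyclicity \<open>a\<close> and \<open>b\<close> are not descendants of each other at
  once, so one of them can serve as the start whose parents separate. Naming the pair only up to
  order absorbs this choice without any reversal of walks.\<close>

lemma non_adjacent_d_separated:
  assumes "dag V D" "a \<in> V" "b \<in> V" "a \<noteq> b" "\<not> adjacent D a b"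
  obtains x y S where "{x, y} = {a, b}" "d_separated V D {x} {y} S"
proof (cases "(b, a) \<in> D\<^sup>*")
  case True
  then have "(a, b) \<notin> D\<^sup>*"
    using assms(1,4) unfolding dag_def acyclic_def
    by (metis rtranclD trancl_trans)
  then show ?thesis
    using d_separated_parents[of V D b a] assms that[of a b] by (auto simp: adjacent_sym)
next
  case False
  then show ?thesis
    using d_separated_parents[of V D a b] assms that[of b a] by auto
qed

lemma d_separatedD:
  assumes "d_separated V D {a} {b} S" "active_walk V D S w" "hd w = a" "last w = b"
  shows False
  using assms unfolding d_separated_def active_walk_def by blast

lemma active_walk_edge:
  assumes "adjacent D a b" "a \<in> V" "b \<in> V" "a \<notin> S" "b \<notin> S"
  shows "active_walk V D S [a, b]"
  using assms
  by (auto simp: active_walk_def walk_def adjacent_def collider_at_def less_Suc_eq nth_Cons')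

lemma active_walk_two_edges:
  assumes "adjacent D a c" "adjacent D c b" "a \<in> V" "b \<in> V" "c \<in> V" "a \<notin> S" "b \<notin> S"
    and "(a, c) \<in> D \<and> (b, c) \<in> D \<longleftrightarrow> c \<in> S"
  shows "active_walk V D S [a, c, b]"
  using assms
  by (auto simp: active_walk_def walk_def adjacent_def collider_at_def less_Suc_eq nth_Cons')

lemma separation_equivalent_sym:
  "separation_equivalent V D1 D2 \<Longrightarrow> separation_equivalent V D2 D1"
  by (simp add: separation_equivalent_def)

text \<open>An edge is by itself an active walk relative to every set that avoids its ends, whereas
  non-adjacent vertices have a separating set.\<close>

lemma separation_equivalent_adjacent:
  assumes "dag V D1" "dag V D2" "separation_equivalent V D1 D2" "adjacent D1 a b"
  shows "adjacent D2 a b"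
proof (rule ccontr)
  assume non: "\<not> adjacent D2 a b"
  have ab: "a \<in> V" "b \<in> V" "a \<noteq> b"
    using assms(1,4) dag_antisym[OF assms(1)] by (auto simp: adjacent_def dag_def)
  obtain x y S where xy: "{x, y} = {a, b}" "d_separated V D2 {x} {y} S"
    using non_adjacent_d_separated[OF assms(2) ab non] .
  then have sep: "d_separated V D1 {x} {y} S"
    using assms(3) by (simp add: separation_equivalent_def)
  have "adjacent D1 x y"
    using xy(1) assms(4) by (auto simp: doubleton_eq_iff adjacent_sym)
  then have "active_walk V D1 S [x, y]"
    using sep by (intro active_walk_edge) (auto simp: d_separated_def)
  then show False
    by (rule d_separatedD[OF sep]) simp_all
qed

lemma separation_equivalent_unshielded_collider:
  assumes "dag V D1" "dag V D2" "separation_equivalent V D1 D2"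
    and "(a, c) \<in> D1" "(b, c) \<in> D1" "a \<noteq> b" "\<not> adjacent D1 a b"
  shows "(a, c) \<in> D2 \<and> (b, c) \<in> D2"
proof (rule ccontr)
  assume no: "\<not> ((a, c) \<in> D2 \<and> (b, c) \<in> D2)"
  have V: "a \<in> V" "b \<in> V" "c \<in> V"
    using assms(1,4,5) by (auto simp: dag_def)
  obtain x y S where xy: "{x, y} = {a, b}" and sep1: "d_separated V D1 {x} {y} S"
    using non_adjacent_d_separated[OF assms(1) V(1,2) assms(6,7)] .
  then have sep2: "d_separated V D2 {x} {y} S"
    using assms(3) by (simp add: separation_equivalent_def)
  have in1: "(x, c) \<in> D1" "(y, c) \<in> D1"
    using xy assms(4,5) by (auto simp: doubleton_eq_iff)
  then have adj: "adjacent D x c" "adjacent D c y" if "D \<in> {D1, D2}" for D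
    using that separation_equivalent_adjacent[OF assms(1-3)] by (auto simp: adjacent_def)
  have no': "\<not> ((x, c) \<in> D2 \<and> (y, c) \<in> D2)"
    using xy no by (auto simp: doubleton_eq_iff)
  have xyS: "x \<in> V" "y \<in> V" "x \<notin> S" "y \<notin> S"
    using sep1 by (auto simp: d_separated_def)
  show False
  \<comment> \<open>The walk through \<open>c\<close> exists in both graphs. If \<open>c\<close>
    lies in the separating set, the collider opens it in \<open>D1\<close>; otherwise the
    non-collider opens it in \<open>D2\<close>.\<close>
  proof (cases "c \<in> S")
    case True
    then have "active_walk V D1 S [x, c, y]"
      using adj xyS V in1 by (intro active_walk_two_edges) auto
    then show False
      by (rule d_separatedD[OF sep1]) simp_all
  next
    case False
    then have "active_walk V D2 S [x, c, y]"
      using adj xyS V no' by (intro active_walk_two_edges) auto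
    then show False
      by (rule d_separatedD[OF sep2]) simp_all
  qed
qed

lemma dag_ex_sink:
  assumes "finite V" "dag V D" "T \<noteq> {}"
  obtains w where "w \<in> T" "\<And>x. x \<in> T \<Longrightarrow> (w, x) \<notin> D"
proof -
  have "finite D"
    using assms(1,2) finite_subset[of D "V \<times> V"] by (auto simp: dag_def)
  then have "wf (D\<inverse>)"
    using assms(2) by (intro finite_acyclic_wf_converse) (auto simp: dag_def)
  then show ?thesis
    using assms(3) that unfolding wf_eq_minimal by (metis converse.intros ex_in_conv)
qed

lemma partial_families_mono:
  assumes "finite V" "dag V D1" "dag V D2"
    and adj: "\<And>a b. adjacent D1 a b \<Longrightarrow> adjacent D2 a b"
    and collider: "\<And>a b c. (a, c) \<in> D1 \<Longrightarrow> (b, c) \<in> D1 \<Longrightarrow> a \<noteq> b \<Longrightarrow> \<not> adjacent D1 a b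
      \<Longrightarrow> (a, c) \<in> D2 \<and> (b, c) \<in> D2"
  shows "partial_families V D1 \<subseteq> partial_families V D2"
proof
  fix T
  assume "T \<in> partial_families V D1"
  then obtain v A where v: "v \<in> V" "T = insert v A" "A \<subseteq> parents D1 v"
    by (auto simp: partial_families_def)
  have into_v: "(x, v) \<in> D1" if "x \<in> T" "x \<noteq> v" for x
    using v that by (auto simp: parents_def)
  obtain w where w: "w \<in> T" "\<And>x. x \<in> T \<Longrightarrow> (w, x) \<notin> D2"
    using dag_ex_sink[OF assms(1,3), of T] v(2) by blast
  have "(x, w) \<in> D2" if x: "x \<in> T" "x \<noteq> w" for x
  proof -
    have "adjacent D2 x w"
    proof (cases "x = v \<or> w = v")
      case True
      then show ?thesis
        using into_v w(1) x adj by (metis adjacent_def)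
    next
      case False
      \<comment> \<open>Here \<open>D1\<close> has arrows from both \<open>x\<close> and
        \<open>w\<close> into \<open>v\<close>. Were \<open>x\<close> and \<open>w\<close>
        non-adjacent in \<open>D1\<close>, this unshielded collider would put the arrow from
        \<open>w\<close> to \<open>v\<close> into \<open>D2\<close>, but \<open>w\<close> is a sink
        of \<open>T\<close> there.\<close>
      then show ?thesis
        using collider[of x v w] into_v x w v(2) adj by blast
    qed
    then show ?thesis
      using w(2) x(1) by (auto simp: adjacent_def)
  qed
  then have "T - {w} \<subseteq> parents D2 w"
    by (auto simp: parents_def)
  moreover have "w \<in> V" "T = insert w (T - {w})"
    using w(1) v dag_subset_parents[OF assms(2)] by auto
  ultimately show "T \<in> partial_families V D2"
    unfolding partial_families_def by blast
qed

lemma separation_equivalent_partial_families: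
  assumes "finite V" "dag V D1" "dag V D2" "separation_equivalent V D1 D2"
  shows "partial_families V D1 = partial_families V D2"
proof -
  have "partial_families V D \<subseteq> partial_families V E"
    if D: "dag V D" and E: "dag V E" and eq: "separation_equivalent V D E" for D E
    using separation_equivalent_adjacent[OF D E eq]
      separation_equivalent_unshielded_collider[OF D E eq]
    by (rule partial_families_mono[OF assms(1) D E])
  then show ?thesis
    using assms separation_equivalent_sym by blast
qed

text \<open>The difference at \<open>v\<close> keeps exactly the subsets of the family of
  \<open>v\<close> that contain \<open>v\<close>. Since no set is kept for two different vertices,
  the sums over \<open>v\<close> combine into one sum over a disjoint union.\<close>

lemma sum_family_differences:
  fixes g :: "'v set \<Rightarrow> 'a :: ab_group_add"
  assumes "finite V" "dag V D"
    and f: "\<And>A. finite A \<Longrightarrow> f A = sum g (Pow A)"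
  shows "(\<Sum>v\<in>V. f (insert v (parents D v)) - f (parents D v)) = sum g (partial_families V D)"
proof -
  have fin: "finite (parents D v)" for v
    using assms(1) dag_subset_parents[OF assms(2)] by (rule rev_finite_subset)
  have "f (insert v (parents D v)) - f (parents D v) = sum g (insert v ` Pow (parents D v))" for v
  proof -
    have "Pow (parents D v) \<inter> insert v ` Pow (parents D v) = {}"
      using dag_not_parent_self[OF assms(2), of v] by auto
    then have "sum g (Pow (insert v (parents D v))) =
        sum g (Pow (parents D v)) + sum g (insert v ` Pow (parents D v))"
      unfolding Pow_insert using fin by (intro sum.union_disjoint) simp_all
    then show ?thesis
      using fin f[of "parents D v"] f[of "insert v (parents D v)"] by simp
  qed
  moreover have "insert v ` Pow (parents D v) \<inter> insert w ` Pow (parents D w) = {}" if "v \<noteq> w" for v w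
  proof (rule ccontr)
    assume "insert v ` Pow (parents D v) \<inter> insert w ` Pow (parents D w) \<noteq> {}"
    then obtain A B where AB: "A \<subseteq> parents D v" "B \<subseteq> parents D w" "insert v A = insert w B"
      by blast
    \<comment> \<open>A set kept for both \<open>v\<close> and \<open>w\<close> contains both, which
      makes each a parent of the other.\<close>
    have "w \<in> insert v A"
      by (simp add: AB(3))
    moreover have "v \<in> insert w B"
      by (simp flip: AB(3))
    ultimately have "(w, v) \<in> D" "(v, w) \<in> D"
      using AB(1,2) that by (auto simp: parents_def)
    then show False
      using dag_antisym[OF assms(2)] by simp
  qed
  ultimately show ?thesis
    unfolding partial_families_def using assms(1) fin by (simp add: sum.UNION_disjoint)
qed

lemma ex_moebius_inverse:
  fixes f :: "'v set \<Rightarrow> 'a :: ring_1"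
  obtains g where "\<And>A. finite A \<Longrightarrow> f A = sum g (Pow A)"
proof (rule that)
  fix A :: "'v set"
  assume "finite A"
  \<comment> \<open>The two signs multiply to the Moebius function of the subset lattice, with value
    -1 to the power \<open>card (T - U)\<close>. The outer sign belongs to \<open>g\<close>.\<close>
  then show "f A = (\<Sum>T\<in>Pow A. (- 1) ^ card T * (\<Sum>U\<in>Pow T. (- 1) ^ card U * f U))"
    by (rule inclusion_exclusion_symmetric[where f = f, OF refl])
qed

lemma separation_equivalent_sum_family_differences:
  fixes f :: "'v set \<Rightarrow> 'a :: ring_1"
  assumes "finite V" "dag V D1" "dag V D2" "separation_equivalent V D1 D2"
  shows "(\<Sum>v\<in>V. f (insert v (parents D1 v)) - f (parents D1 v)) =
    (\<Sum>v\<in>V. f (insert v (parents D2 v)) - f (parents D2 v))"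
proof -
  obtain g where g: "\<And>A. finite A \<Longrightarrow> f A = sum g (Pow A)"
    using ex_moebius_inverse[of f] by blast
  have "(\<Sum>v\<in>V. f (insert v (parents D v)) - f (parents D v)) = sum g (partial_families V D)"
    if "dag V D" for D
    using assms(1) that g by (rule sum_family_differences)
  then show ?thesis
    using assms(2,3) separation_equivalent_partial_families[OF assms] by metis
qed

theorem proposition6p4:
  fixes V :: "'v set"
    and X :: "'v \<Rightarrow> 'b set"
    and D1 D2 :: "('v \<times> 'v) set"
    and \<sigma> :: "('v \<Rightarrow> 'b) oper"
  assumes "finite V"
    and "\<And>v. v \<in> V \<Longrightarrow> finite (X v)"
    and "dag V D1"
    and "dag V D2"
    and "separation_equivalent V D1 D2"
    and "\<sigma> \<in> states X V"
  shows "T_op X V D1 \<sigma> = T_op X V D2 \<sigma> \<and> gI X V D1 \<sigma> = gI X V D2 \<sigma>"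
proof -
  note eq = separation_equivalent_sum_family_differences[OF assms(1,3-5)]
  \<comment> \<open>The identity is applied to each matrix entry, with complex-valued
    \<open>f\<close>: already the exponents agree, before \<open>op_exp\<close> is taken.\<close>
  have "T_op X V D1 \<sigma> = T_op X V D2 \<sigma>"
    unfolding T_op_def insert_is_Un[symmetric]
    using eq[of "\<lambda>A. embed X V A (log_marginal X V A \<sigma>) _ _"] by simp
  moreover have "gI X V D1 \<sigma> = gI X V D2 \<sigma>"
    unfolding gI_def insert_is_Un[symmetric]
    using eq[of "\<lambda>A. entropy X V A \<sigma>"] by simp
  ultimately show ?thesis ..
qed

end
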